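(* Let $H=(\sigma,\alpha)$ be a connected orientable hypermap with dart set $D$, and let $E'\subseteq E(H)$. The state circles of the state $S_{E'}$ of the medial map $M(H)$ are in bijection with the vertices of the partial dual $H^{E'}$. More precisely, the darts belonging to a given state circle (i.e. the darts $i$ whose medial edge $m_i$ lies on that circle) form a cycle of the permutation $\sigma^{E'}$, and the length of the state circle equals the length of that cycle.
   Context: Permutations are composed from right to left. A connected orientable hypermap is a pair $H=(\sigma,\alpha)$ of permutations of a finite set $D=\{1,\dots,n\}$ of darts such that the group generated by $\sigma,\alpha$ acts transitively on $D$. Vertices are the cycles of $\sigma$ and hyperedges are the cycles of $\alpha$ (fixed points count as cycles of length 1); $E(H)$ is the set of hyperedges. Partial dual. For $E'\subseteq E(H)$, let $\alpha_{E'}$ be the product of the $\alpha$-cycles in $E'$ and $\alpha_{\overline{E'}}$ the product of the remaining $\alpha$-cycles. The partial dual is the hypermap $H^{E'}=(\sigma^{E'},\alpha^{E'})$ with vertex permutation $\sigma^{E'}=\alpha_{E'}^{-1}\sigma$ and hyperedge permutation $\alpha^{E'}=\alpha_{E'}^{-1}\alpha_{\overline{E'}}$. Medial map. Let $D^{\pm}=\{i^-,i^+: i\in D\}$ (the half-edges of $M(H)$). The medial map $M(H)$ has one vertex $v_e$ for each hyperedge $e=(i_1\,i_2\cdots i_k)$, with cyclic order of half-edges $(i_1^-\,i_1^+\,i_2^-\,i_2^+\cdots i_k^-\,i_k^+)$, and one edge $m_i=(i^+,\sigma(i)^-)$ for each dart $i\in D$, with ends $i^+$ and $\sigma(i)^-$.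 At $v_e$ the black corners are the pairs $(i_j^-,i_j^+)$ and the white corners are the pairs $(i_j^+,i_{j+1}^-)$, $1\le j\le k$, $i_{k+1}:=i_1$. States. The black smoothing at $v_e$ removes $v_e$ and connects, for every $j$, the two half-edges $i_j^-,i_j^+$ of each black corner; the white smoothing at $v_e$ removes $v_e$ and connects, for every $j$, the two half-edges $i_j^+,i_{j+1}^-$ of each white corner (each such connection is a degree-2 vertex). The state $S_{E'}$ is the 2-regular graph obtained from $M(H)$ by applying the white smoothing at $v_e$ for every $e\in E'$ and the black smoothing at $v_e$ for every $e\notin E'$. Its connected components are the state circles; the length of a state circle is the number of medial edges $m_i$ it contains. *)

theory Defs
  imports "HOL-Combinatorics.Orbits" "HOL-Algebra.Sym_Groups"
begin

section \<open>Hypermaps\<close>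

record hypermap =
  num_darts :: nat
  sigma :: "nat \<Rightarrow> nat"
  alpha :: "nat \<Rightarrow> nat"

definition darts :: "hypermap \<Rightarrow> nat set" where
  "darts H = {1..num_darts H}"

definition connected_hypermap :: "hypermap \<Rightarrow> bool" where
  "connected_hypermap H \<longleftrightarrow>
     sigma H permutes darts H \<and> alpha H permutes darts H \<and>
     (\<forall>x\<in>darts H. \<forall>y\<in>darts H.
        \<exists>g\<in>generate (sym_group (num_darts H)) {sigma H, alpha H}. g x = y)"

text \<open>A cycle of a permutation is represented by the set of darts it moves around (a singleton for
  a fixed point); the permutation itself supplies the cyclic order. In particular distinct fixed
  points are distinct cycles, and the length of a cycle is the cardinality of the set.\<close>

definition vertices :: "hypermap \<Rightarrow> nat set set" where
  "vertices H = orbit (sigma H) ` darts H"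

definition hyperedges :: "hypermap \<Rightarrow> nat set set" where
  "hyperedges H = orbit (alpha H) ` darts H"

section \<open>Partial duals\<close>

text \<open>\<open>perm_restrict p c\<close> is the cycle \<open>c\<close> of \<open>p\<close> regarded as a permutation, i.e. extended by the
  identity. Distinct cycles of a permutation commute, so the order of the product is irrelevant.\<close>

definition cycle_product :: "(nat \<Rightarrow> nat) \<Rightarrow> nat set set \<Rightarrow> nat \<Rightarrow> nat" where
  "cycle_product p F = Finite_Set.fold (\<lambda>c q. perm_restrict p c \<circ> q) id F"

definition partial_dual :: "hypermap \<Rightarrow> nat set set \<Rightarrow> hypermap" where
  "partial_dual H E' =
     \<lparr> num_darts = num_darts H,
       sigma = inv' (cycle_product (alpha H) E') \<circ> sigma H,
       alpha = inv' (cycle_product (alpha H) E') \<circ> cycle_product (alpha H) (hyperedges H - E') \<rparr>"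

section \<open>Graphs given by half-edges\<close>

text \<open>A vertex is the set of half-edges attached to it, an edge is the set of its two half-edges.
  Loops and parallel edges are allowed: the edge \<open>{h, h'}\<close> is a loop at any vertex containing
  both \<open>h\<close> and \<open>h'\<close>.\<close>

record 'h half_edge_graph =
  verts :: "'h set set"
  edges :: "'h set set"

definition adjacency :: "('h, 'z) half_edge_graph_scheme \<Rightarrow> ('h set \<times> 'h set) set" where
  "adjacency G = {(u, v). u \<in> verts G \<and> v \<in> verts G \<and>
     (\<exists>e\<in>edges G. e \<inter> u \<noteq> {} \<and> e \<inter> v \<noteq> {})}"

definition component_of ::
  "('h, 'z) half_edge_graph_scheme \<Rightarrow> 'h set \<Rightarrow> 'h half_edge_graph" where
  "component_of G v =
     (let W = {w \<in> verts G. (v, w) \<in> (adjacency G)\<^sup>*}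
      in \<lparr> verts = W, edges = {e \<in> edges G. \<exists>w\<in>W. e \<inter> w \<noteq> {}} \<rparr>)"

definition connected_components ::
  "('h, 'z) half_edge_graph_scheme \<Rightarrow> 'h half_edge_graph set" where
  "connected_components G = component_of G ` verts G"

section \<open>The medial map and its states\<close>

datatype half_edge = Minus nat | Plus nat

text \<open>The rotation lists the half-edges around each vertex in cyclic order.\<close>

record 'h rotation_map = "'h half_edge_graph" +
  rotation :: "'h \<Rightarrow> 'h"

definition medial_vertex :: "nat set \<Rightarrow> half_edge set" where
  "medial_vertex e = Minus ` e \<union> Plus ` e"

definition medial_edge :: "hypermap \<Rightarrow> nat \<Rightarrow> half_edge set" where
  "medial_edge H i = {Plus i, Minus (sigma H i)}"

definition medial_map :: "hypermap \<Rightarrow> half_edge rotation_map" where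
  "medial_map H =
     \<lparr> verts = medial_vertex ` hyperedges H,
       edges = medial_edge H ` darts H,
       rotation = (\<lambda>h. case h of Minus i \<Rightarrow> Plus i | Plus i \<Rightarrow> Minus (alpha H i)) \<rparr>"

text \<open>A corner at a medial vertex is a pair of half-edges that are consecutive in the rotation.
  Smoothing turns such a pair into a vertex of degree two.\<close>

definition black_corners :: "hypermap \<Rightarrow> nat set \<Rightarrow> half_edge set set" where
  "black_corners H e = {{Minus i, rotation (medial_map H) (Minus i)} | i. i \<in> e}"

definition white_corners :: "hypermap \<Rightarrow> nat set \<Rightarrow> half_edge set set" where
  "white_corners H e = {{Plus i, rotation (medial_map H) (Plus i)} | i. i \<in> e}"

definition state :: "hypermap \<Rightarrow> nat set set \<Rightarrow> half_edge half_edge_graph" where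
  "state H E' =
     \<lparr> verts = (\<Union>e\<in>E'. white_corners H e) \<union> (\<Union>e\<in>hyperedges H - E'. black_corners H e),
       edges = edges (medial_map H) \<rparr>"

definition state_circles :: "hypermap \<Rightarrow> nat set set \<Rightarrow> half_edge half_edge_graph set" where
  "state_circles H E' = connected_components (state H E')"

definition circle_darts :: "hypermap \<Rightarrow> half_edge half_edge_graph \<Rightarrow> nat set" where
  "circle_darts H C = {i \<in> darts H. medial_edge H i \<in> edges C}"

definition circle_length :: "half_edge half_edge_graph \<Rightarrow> nat" where
  "circle_length C = card (edges C)"

section \<open>Consistency of the encodings\<close>

lemma black_corners_eq: "black_corners H e = {{Minus i, Plus i} | i. i \<in> e}"
  by (simp add: black_corners_def medial_map_def)

lemma white_corners_eq: "white_corners H e = {{Plus i, Minus (alpha H i)} | i. i \<in> e}"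
  by (simp add: white_corners_def medial_map_def)

lemma hyperedge_cyclic:
  assumes "connected_hypermap H" "e \<in> hyperedges H"
  shows "cyclic_on (alpha H) e"
proof -
  have "alpha H permutes darts H" "finite (darts H)"
    using assms(1) by (simp_all add: connected_hypermap_def darts_def)
  with assms(2) show ?thesis
    by (auto simp: hyperedges_def intro: cyclic_on_orbit)
qed

lemma hyperedges_disjoint:
  assumes "connected_hypermap H" "c \<in> hyperedges H" "d \<in> hyperedges H" "c \<noteq> d"
  shows "c \<inter> d = {}"
  using orbit_cyclic_eq3[OF hyperedge_cyclic[OF assms(1,2)]]
    orbit_cyclic_eq3[OF hyperedge_cyclic[OF assms(1,3)]] assms(4) by auto

lemma cycle_product_eq_perm_restrict:
  assumes H: "connected_hypermap H" and F: "F \<subseteq> hyperedges H"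
  shows "cycle_product (alpha H) F = perm_restrict (alpha H) (\<Union>F)"
proof -
  let ?a = "alpha H"
  have comm: "perm_restrict ?a c \<circ> perm_restrict ?a d = perm_restrict ?a d \<circ> perm_restrict ?a c"
    if "c \<in> hyperedges H" "d \<in> hyperedges H" for c d
  proof (cases "c = d")
    case False
    then have "c \<inter> d = {}" "d \<inter> c = {}"
      using hyperedges_disjoint[OF H that] by auto
    then show ?thesis
      using hyperedge_cyclic[OF H] that by (simp add: perm_restrict_comp Un_commute)
  qed simp
  interpret comp_fun_commute_on "hyperedges H" "\<lambda>c q. perm_restrict ?a c \<circ> q"
  proof
    fix c d assume "c \<in> hyperedges H" "d \<in> hyperedges H"
    from comm[OF this]
    show "(\<circ>) (perm_restrict ?a d) \<circ> (\<circ>) (perm_restrict ?a c) =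
          (\<circ>) (perm_restrict ?a c) \<circ> (\<circ>) (perm_restrict ?a d)"
      by (intro ext) (simp only: comp_apply o_assoc)
  qed
  have "finite F"
    using F by (rule finite_subset) (simp add: hyperedges_def darts_def)
  then show ?thesis
    using F
  proof (induction F)
    case empty
    then show ?case by (simp add: cycle_product_def perm_restrict_def fun_eq_iff)
  next
    case (insert c F)
    have "cycle_product ?a (insert c F) = perm_restrict ?a c \<circ> cycle_product ?a F"
      using insert.prems insert.hyps fold_insert[of c F id] by (simp add: cycle_product_def)
    also have "\<dots> = perm_restrict ?a c \<circ> perm_restrict ?a (\<Union>F)"
      using insert by simp
    also have "\<dots> = perm_restrict ?a (c \<union> \<Union>F)"
    proof
      fix x
      have "?a x \<notin> c" if "x \<in> \<Union>F"
      proof -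
        from that obtain d where d: "d \<in> F" "x \<in> d" by blast
        then have "?a x \<in> d"
          using insert.prems cyclic_on_inI[OF hyperedge_cyclic[OF H]] by blast
        moreover have "c \<inter> d = {}"
          using insert.prems insert.hyps d by (intro hyperedges_disjoint[OF H]) blast+
        ultimately show ?thesis by blast
      qed
      then show "(perm_restrict ?a c \<circ> perm_restrict ?a (\<Union>F)) x = perm_restrict ?a (c \<union> \<Union>F) x"
        by (auto simp: perm_restrict_def)
    qed
    finally show ?case by simp
  qed
qed

end

theory Submission
  imports Defs
begin

text \<open>
  Write \<open>a\<close> for the product of the hyperedge cycles in \<open>E'\<close>, that is, the permutation which agrees
  with \<open>\<alpha>\<close> on the darts of \<open>E'\<close> and fixes all the others. A black corner \<open>(j\<^sup>-, j\<^sup>+)\<close> and a white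
  corner \<open>(j\<^sup>+, \<alpha>(j)\<^sup>-)\<close> are then both of the form \<open>{j\<^sup>+, a(j)\<^sup>-}\<close>, so the vertices of the state are
  exactly these pairs, one for each dart \<open>j\<close> (lemma \<open>verts_state\<close>).

  The medial edge \<open>m\<^sub>i = {i\<^sup>+, \<sigma>(i)\<^sup>-}\<close> meets the pair of \<open>j\<close> in \<open>i\<^sup>+\<close> if \<open>j = i\<close> and in \<open>\<sigma>(i)\<^sup>-\<close> if
  \<open>a(j) = \<sigma>(i)\<close>, that is, if \<open>j = a\<^sup>-\<^sup>1\<sigma>(i)\<close>. But \<open>a\<^sup>-\<^sup>1\<sigma>\<close> is the vertex permutation \<open>p\<close> of the partial
  dual. Hence each \<open>m\<^sub>i\<close> joins the pair of \<open>i\<close> to the pair of \<open>p(i)\<close>, and walking along a state circle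
  is the same as iterating \<open>p\<close>: the state circles are the orbits of \<open>p\<close> (lemma
  \<open>component_of_functional_graph\<close>), and each dart of an orbit contributes exactly one medial edge.
\<close>

section \<open>Graphs whose edges join each vertex to its image under a permutation\<close>

lemma in_orbit_iff_image_in_orbit:
  assumes "finite D" "p permutes D"
  shows "p k \<in> orbit p i \<longleftrightarrow> k \<in> orbit p i"
proof
  assume *: "p k \<in> orbit p i"
  have "permutation p"
    using assms permutation_permutes by blast
  then have "k \<in> orbit p k"
    by (rule permutation_self_in_orbit)
  then have "k \<in> orbit p (p k)"
    using \<open>permutation p\<close> permutation_orbit_step by metis
  then show "k \<in> orbit p i"
    using * by (rule orbit_trans)
qed (rule orbit.step)

text \<open>Reachability is symmetric although orbits are generated by forward steps only, because a
  permutation of a finite set returns to its starting point. So a path in the graph, which may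
  traverse edges in either direction, never leaves the labels in one orbit.\<close>

lemma component_of_functional_graph:
  assumes fin: "finite D" and p: "p permutes D"
    and G: "verts G = V ` D" "edges G = m ` D"
    and incident: "\<And>i j. i \<in> D \<Longrightarrow> j \<in> D \<Longrightarrow> m i \<inter> V j \<noteq> {} \<longleftrightarrow> j = i \<or> j = p i"
    and i: "i \<in> D"
  shows "component_of G (V i) = \<lparr>verts = V ` orbit p i, edges = m ` orbit p i\<rparr>"
proof -
  have orbit_D: "orbit p i \<subseteq> D"
    using p i by (rule permutes_orbit_subset)
  have "permutation p"
    using fin p permutation_permutes by blast
  then have self: "i \<in> orbit p i"
    by (rule permutation_self_in_orbit)
  have step_iff: "p k \<in> orbit p i \<longleftrightarrow> k \<in> orbit p i" for k
    using fin p by (rule in_orbit_iff_image_in_orbit)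
  have p_D: "p k \<in> D" if "k \<in> D" for k
    using p that by (simp add: permutes_in_image)
  have adj: "(V k, V (p k)) \<in> adjacency G" if "k \<in> D" for k
  proof -
    have "m k \<inter> V k \<noteq> {}" "m k \<inter> V (p k) \<noteq> {}"
      using incident that p_D by simp_all
    then show ?thesis
      using that p_D unfolding adjacency_def G by blast
  qed
  have reach: "(V i, V j) \<in> (adjacency G)\<^sup>*" if "j \<in> orbit p i" for j
    using that
  proof induction
    case base
    then show ?case using adj[OF i] by blast
  next
    case (step y)
    then show ?case using adj[of y] orbit_D by (meson rtrancl.rtrancl_into_rtrancl subsetD)
  qed
  have only: "w \<in> V ` orbit p i" if "(V i, w) \<in> (adjacency G)\<^sup>*" for w
    using that
  proof induction
    case base
    then show ?case using self by blast
  next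
    case (step u w)
    then obtain j where j: "j \<in> orbit p i" "u = V j"
      by blast
    obtain k l where kl: "k \<in> D" "w = V k" "l \<in> D" "m l \<inter> V j \<noteq> {}" "m l \<inter> V k \<noteq> {}"
      using step.hyps(2) j(2) unfolding adjacency_def G by blast
    have "j = l \<or> j = p l"
      using incident[of l j] kl j(1) orbit_D by blast
    then have "l \<in> orbit p i"
      using j(1) step_iff by blast
    moreover have "k = l \<or> k = p l"
      using incident[of l k] kl by blast
    ultimately show ?case
      using step_iff kl(2) by blast
  qed
  have W: "{w \<in> verts G. (V i, w) \<in> (adjacency G)\<^sup>*} = V ` orbit p i"
    using reach only orbit_D unfolding G by blast
  have edge: "(\<exists>w\<in>V ` orbit p i. m l \<inter> w \<noteq> {}) \<longleftrightarrow> l \<in> orbit p i" if "l \<in> D" for l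
  proof
    assume "\<exists>w\<in>V ` orbit p i. m l \<inter> w \<noteq> {}"
    then obtain j where "j \<in> orbit p i" "m l \<inter> V j \<noteq> {}"
      by blast
    then show "l \<in> orbit p i"
      using incident[of l j] that orbit_D step_iff by blast
  next
    assume "l \<in> orbit p i"
    then show "\<exists>w\<in>V ` orbit p i. m l \<inter> w \<noteq> {}"
      using incident[of l l] that by blast
  qed
  have "{e \<in> edges G. \<exists>w\<in>V ` orbit p i. e \<inter> w \<noteq> {}} = m ` orbit p i"
    using edge orbit_D unfolding G by blast
  then show ?thesis
    by (simp add: component_of_def W)
qed

section \<open>The vertex permutation of the partial dual\<close>

lemma perm_restrict_permutes:
  assumes "finite A" "inj_on f A" "f ` A \<subseteq> A"
  shows "perm_restrict f A permutes A"
proof (rule bij_imp_permutes)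
  have "bij_betw f A A"
    using assms by (simp add: bij_betw_def endo_inj_surj)
  then show "bij_betw (perm_restrict f A) A A"
    by (simp add: perm_restrict_simps cong: bij_betw_cong)
qed (simp add: perm_restrict_simps)

lemma finite_darts: "finite (darts H)"
  by (simp add: darts_def)

lemma Union_hyperedges:
  assumes "connected_hypermap H"
  shows "\<Union>(hyperedges H) = darts H"
proof
  have alpha: "alpha H permutes darts H"
    using assms by (simp add: connected_hypermap_def)
  show "\<Union>(hyperedges H) \<subseteq> darts H"
    using permutes_orbit_subset[OF alpha] by (auto simp: hyperedges_def)
  have "permutation (alpha H)"
    using alpha finite_darts permutation_permutes by blast
  then have "x \<in> orbit (alpha H) x" for x
    by (rule permutation_self_in_orbit)
  then show "darts H \<subseteq> \<Union>(hyperedges H)"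
    by (auto simp: hyperedges_def)
qed

lemma cycle_product_permutes:
  assumes H: "connected_hypermap H" and E: "E' \<subseteq> hyperedges H"
  shows "cycle_product (alpha H) E' permutes darts H"
proof -
  have sub: "\<Union>E' \<subseteq> darts H"
    using Union_hyperedges[OF H] E by blast
  have "alpha H permutes darts H"
    using H by (simp add: connected_hypermap_def)
  then have "inj_on (alpha H) (\<Union>E')"
    by (rule permutes_inj_on)
  moreover have "finite (\<Union>E')"
    using sub finite_darts by (rule finite_subset)
  moreover have "alpha H ` \<Union>E' \<subseteq> \<Union>E'"
    using E cyclic_on_inI[OF hyperedge_cyclic[OF H]] by blast
  ultimately have "perm_restrict (alpha H) (\<Union>E') permutes \<Union>E'"
    by (intro perm_restrict_permutes)
  then show ?thesis
    using sub cycle_product_eq_perm_restrict[OF H E] permutes_subset by metis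
qed

lemma sigma_partial_dual_permutes:
  assumes H: "connected_hypermap H" and E: "E' \<subseteq> hyperedges H"
  shows "sigma (partial_dual H E') permutes darts H"
proof -
  have "sigma H permutes darts H"
    using H by (simp add: connected_hypermap_def)
  then show ?thesis
    using permutes_inv[OF cycle_product_permutes[OF H E]]
    by (simp add: partial_dual_def permutes_compose)
qed

lemma darts_partial_dual: "darts (partial_dual H E') = darts H"
  by (simp add: darts_def partial_dual_def)

section \<open>The state as a graph on the darts\<close>

text \<open>The corner that survives at the half-edge \<open>Plus j\<close>: it is black if \<open>a\<close> fixes \<open>j\<close> because \<open>j\<close>
  lies outside \<open>E'\<close>, and white if \<open>a\<close> acts on \<open>j\<close> as \<open>\<alpha>\<close>.\<close>

definition smoothed_corner :: "(nat \<Rightarrow> nat) \<Rightarrow> nat \<Rightarrow> half_edge set" where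
  "smoothed_corner a j = {Plus j, Minus (a j)}"

lemma verts_state:
  assumes H: "connected_hypermap H" and E: "E' \<subseteq> hyperedges H"
  shows "verts (state H E') = smoothed_corner (cycle_product (alpha H) E') ` darts H"
proof -
  let ?V = "smoothed_corner (cycle_product (alpha H) E')"
  note restrict = cycle_product_eq_perm_restrict[OF H E]
  \<comment> \<open>Distinct cycles are disjoint, so \<open>a\<close> fixes every dart of a hyperedge that gets a black smoothing.\<close>
  have black: "\<Union>(hyperedges H - E') \<inter> \<Union>E' = {}"
    using E hyperedges_disjoint[OF H] by blast
  have "(\<Union>e\<in>E'. white_corners H e) = ?V ` \<Union>E'"
  proof -
    have "?V j = {Plus j, Minus (alpha H j)}" if "j \<in> \<Union>E'" for j
      using that by (simp only: smoothed_corner_def restrict perm_restrict_simps)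
    then have "?V ` \<Union>E' = (\<lambda>j. {Plus j, Minus (alpha H j)}) ` \<Union>E'"
      by (intro image_cong refl)
    then show ?thesis
      unfolding white_corners_eq by auto
  qed
  moreover have "(\<Union>e\<in>hyperedges H - E'. black_corners H e) = ?V ` \<Union>(hyperedges H - E')"
  proof -
    have "?V j = {Minus j, Plus j}" if "j \<in> \<Union>(hyperedges H - E')" for j
    proof -
      have "j \<notin> \<Union>E'"
        using black that by blast
      then show ?thesis
        by (auto simp: smoothed_corner_def restrict perm_restrict_def)
    qed
    then have "?V ` \<Union>(hyperedges H - E')
        = (\<lambda>j. {Minus j, Plus j}) ` \<Union>(hyperedges H - E')"
      by (intro image_cong refl)
    then show ?thesis
      unfolding black_corners_eq by auto
  qed
  moreover have "\<Union>E' \<union> \<Union>(hyperedges H - E') = darts H"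
    using E Union_hyperedges[OF H] by blast
  ultimately show ?thesis
    by (simp add: state_def flip: image_Un)
qed

lemma edges_state: "edges (state H E') = medial_edge H ` darts H"
  by (simp add: state_def medial_map_def)

lemma medial_edge_meets_smoothed_corner_iff:
  assumes H: "connected_hypermap H" and E: "E' \<subseteq> hyperedges H"
  shows "medial_edge H i \<inter> smoothed_corner (cycle_product (alpha H) E') j \<noteq> {}
    \<longleftrightarrow> j = i \<or> j = sigma (partial_dual H E') i"
proof -
  have "j = inv' (cycle_product (alpha H) E') (sigma H i)
      \<longleftrightarrow> cycle_product (alpha H) E' j = sigma H i"
    using permutes_inv_eq[OF cycle_product_permutes[OF H E]] by metis
  then show ?thesis
    by (auto simp: medial_edge_def smoothed_corner_def partial_dual_def)
qed

lemma inj_medial_edge: "inj (medial_edge H)"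
  by (auto simp: inj_def medial_edge_def doubleton_eq_iff)

section \<open>State circles and vertices of the partial dual\<close>

definition circle_of_orbit :: "hypermap \<Rightarrow> nat set set \<Rightarrow> nat set \<Rightarrow> half_edge half_edge_graph"
  where "circle_of_orbit H E' c =
    \<lparr>verts = smoothed_corner (cycle_product (alpha H) E') ` c, edges = medial_edge H ` c\<rparr>"

lemma state_circles_eq:
  assumes H: "connected_hypermap H" and E: "E' \<subseteq> hyperedges H"
  shows "state_circles H E' = circle_of_orbit H E' ` vertices (partial_dual H E')"
proof -
  have "component_of (state H E') (smoothed_corner (cycle_product (alpha H) E') i)
      = circle_of_orbit H E' (orbit (sigma (partial_dual H E')) i)" if "i \<in> darts H" for i
    unfolding circle_of_orbit_def
    using finite_darts sigma_partial_dual_permutes[OF H E] verts_state[OF H E] edges_state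
      medial_edge_meets_smoothed_corner_iff[OF H E] that
    by (rule component_of_functional_graph)
  then show ?thesis
    by (simp add: state_circles_def connected_components_def verts_state[OF H E] vertices_def
        darts_partial_dual image_image)
qed

lemma circle_darts_circle_of_orbit:
  assumes "c \<subseteq> darts H"
  shows "circle_darts H (circle_of_orbit H E' c) = c"
  using assms
  by (auto simp: circle_darts_def circle_of_orbit_def inj_image_mem_iff[OF inj_medial_edge])

lemma circle_length_circle_of_orbit: "circle_length (circle_of_orbit H E' c) = card c"
  by (simp add: circle_length_def circle_of_orbit_def card_image
      inj_on_subset[OF inj_medial_edge])

theorem theorem4p2:
  fixes H :: hypermap and E' :: "nat set set"
  assumes "connected_hypermap H" and "E' \<subseteq> hyperedges H"
  shows "bij_betw (circle_darts H) (state_circles H E') (vertices (partial_dual H E')) \<and>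
         (\<forall>C\<in>state_circles H E'.
            circle_darts H C \<in> vertices (partial_dual H E') \<and>
            circle_length C = card (circle_darts H C))"
proof -
  have "c \<subseteq> darts H" if "c \<in> vertices (partial_dual H E')" for c
    using that permutes_orbit_subset[OF sigma_partial_dual_permutes[OF assms]]
    by (auto simp: vertices_def darts_partial_dual)
  then have darts_circle: "circle_darts H (circle_of_orbit H E' c) = c"
    if "c \<in> vertices (partial_dual H E')" for c
    using that circle_darts_circle_of_orbit by blast
  have "bij_betw (circle_darts H) (state_circles H E') (vertices (partial_dual H E'))"
    unfolding state_circles_eq[OF assms]
    by (rule bij_betw_byWitness[where f' = "circle_of_orbit H E'"]) (auto simp: darts_circle)
  then show ?thesis
    by (auto simp: state_circles_eq[OF assms] darts_circle circle_length_circle_of_orbit)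
qed

end
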